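(* A graph $H$ satisfies $\widehat{\Phi}_{\mathsf{even}}(H)\neq 0$ if and only if $H$ is bipartite.
   Context: All graphs are finite, simple and undirected. $\Phi_{\mathsf{even}}$ is the graph property with $\Phi_{\mathsf{even}}(G)=1$ if every vertex of $G$ has even degree and $0$ otherwise. For a graph property $\Phi$ and a graph $H$, the alternating enumerator is $\widehat{\Phi}(H)=(-1)^{|E(H)|}\sum_{S\subseteq E(H)}(-1)^{|S|}\Phi(H[S])$, where $H[S]=(V(H),S)$. *)

theory Defs
  imports Main
begin

record 'a ugraph =
  verts :: "'a set"
  edges :: "'a set set"

locale finite_simple_graph =
  fixes G :: "'a ugraph"
  assumes finite_verts: "finite (verts G)"
    and edge_subset_verts: "\<And>e. e \<in> edges G \<Longrightarrow> e \<subseteq> verts G"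
    and card_edge: "\<And>e. e \<in> edges G \<Longrightarrow> card e = 2"

definition edge_subgraph :: "'a ugraph \<Rightarrow> 'a set set \<Rightarrow> 'a ugraph" where
  "edge_subgraph G S = \<lparr>verts = verts G, edges = S\<rparr>"

definition vertex_degree :: "'a ugraph \<Rightarrow> 'a \<Rightarrow> nat" where
  "vertex_degree G v = card {e \<in> edges G. v \<in> e}"

definition bipartite :: "'a ugraph \<Rightarrow> bool" where
  "bipartite G \<longleftrightarrow>
     (\<exists>X Y. verts G = X \<union> Y \<and> X \<inter> Y = {} \<and>
        (\<forall>e\<in>edges G. \<exists>x\<in>X. \<exists>y\<in>Y. e = {x, y}))"

(* The values 1 and 0 of a graph property are True and False; of_bool converts them to numbers. *)
type_synonym 'a graph_property = "'a ugraph \<Rightarrow> bool"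

definition Phi_even :: "'a graph_property" where
  "Phi_even G \<longleftrightarrow> (\<forall>v\<in>verts G. even (vertex_degree G v))"

definition alternating_enumerator :: "'a graph_property \<Rightarrow> 'a ugraph \<Rightarrow> int" where
  "alternating_enumerator \<Phi> H =
     (-1) ^ card (edges H) *
       (\<Sum>S\<in>Pow (edges H). (-1) ^ card S * of_bool (\<Phi> (edge_subgraph H S)))"

lemma (in finite_simple_graph) finite_edges: "finite (edges G)"
  using finite_verts edge_subset_verts
  by (meson PowI finite_Pow_iff finite_subset subsetI)

(* The graphs at which the enumerator evaluates its property are finite simple graphs. *)
lemma (in finite_simple_graph) finite_simple_graph_edge_subgraph:
  assumes "S \<subseteq> edges G"
  shows "finite_simple_graph (edge_subgraph G S)"
  using assms finite_verts edge_subset_verts card_edge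
  by (auto simp: finite_simple_graph_def edge_subgraph_def)

end

theory Submission
  imports Defs
begin

text \<open>
  Expand the indicator of ``every degree is even'' into characters: it equals \<open>2 ^ (- |V|)\<close> times
  the sum over vertex sets \<open>A\<close> of the sign \<open>\<Prod>v\<in>A. (- 1) ^ deg v\<close>. After exchanging
  the sums, the sum over edge sets factors over the edges, the factor of an edge being \<open>2\<close> if it
  has exactly one end in \<open>A\<close> and \<open>0\<close> otherwise. So, up to sign and a power of \<open>2\<close>, the enumerator
  counts the vertex sets whose cut contains every edge, and such a set exists iff the graph is
  bipartite.
\<close>

text \<open>Expanding the product picks \<open>f a\<close> for the elements of \<open>B\<close> and
  \<open>1\<close> for the rest.\<close>

lemma sum_Pow_prod:
  fixes f :: "'b \<Rightarrow> 'c::comm_semiring_1"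
  assumes "finite A"
  shows "(\<Sum>B\<in>Pow A. \<Prod>b\<in>B. f b) = (\<Prod>a\<in>A. 1 + f a)"
  using prod_add[OF assms, of f "\<lambda>_. 1"] by (simp add: add.commute)

text \<open>Double counting: both sides multiply one factor \<open>- 1\<close> for each incidence of
  a vertex in \<open>A\<close> with an edge.\<close>

lemma prod_minus_one_degree:
  assumes "finite A" and "finite (edges G)"
  shows "(\<Prod>v\<in>A. (- 1) ^ vertex_degree G v) = (\<Prod>e\<in>edges G. (- 1 :: int) ^ card (e \<inter> A))"
proof -
  have "(- 1 :: int) ^ vertex_degree G v = (\<Prod>e\<in>edges G. if v \<in> e then - 1 else 1)" for v
    using assms(2) by (simp add: vertex_degree_def prod.If_cases Int_def)
  moreover have "(- 1 :: int) ^ card (e \<inter> A) = (\<Prod>v\<in>A. if v \<in> e then - 1 else 1)" for e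
    using assms(1) by (simp add: prod.If_cases Int_commute)
  ultimately show ?thesis
    using prod.swap[of "\<lambda>v e. if v \<in> e then - 1 else 1 :: int" "edges G" A] by simp
qed

text \<open>The sum factors over the vertices, with factor 2 at even degree and 0 at odd degree, so
  one odd vertex kills it.\<close>

lemma sum_characters_even:
  assumes "finite (verts G)"
  shows "(\<Sum>A\<in>Pow (verts G). \<Prod>v\<in>A. (- 1 :: int) ^ vertex_degree G v)
      = 2 ^ card (verts G) * of_bool (Phi_even G)"
proof -
  have "(\<Prod>v\<in>verts G. 1 + (- 1 :: int) ^ vertex_degree G v)
      = 2 ^ card (verts G) * of_bool (Phi_even G)"
  proof (cases "Phi_even G")
    case True
    then show ?thesis by (simp add: Phi_even_def)
  next
    case False
    then obtain v where "v \<in> verts G" "odd (vertex_degree G v)"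
      by (auto simp: Phi_even_def)
    then show ?thesis
      using False assms by (auto intro!: prod_zero bexI[of _ v])
  qed
  then show ?thesis
    using assms by (simp add: sum_Pow_prod)
qed

context finite_simple_graph
begin

text \<open>The minus sign comes from \<open>(- 1) ^ card S\<close>, which gives each edge of
  \<open>S\<close> one factor \<open>- 1\<close>; it makes the edges with odd intersection the
  surviving ones.\<close>

lemma prod_cut_indicator:
  "(\<Prod>e\<in>edges G. 1 - (- 1 :: int) ^ card (e \<inter> A))
    = 2 ^ card (edges G) * of_bool (\<forall>e\<in>edges G. odd (card (e \<inter> A)))"
proof (cases "\<forall>e\<in>edges G. odd (card (e \<inter> A))")
  case True
  then show ?thesis by simp
next
  case False
  then obtain e where "e \<in> edges G" "even (card (e \<inter> A))" by auto
  then show ?thesis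
    using False finite_edges by (auto intro!: prod_zero bexI[of _ e])
qed

text \<open>The factor \<open>2 ^ card (verts G)\<close> stays on the left to avoid division in the
  integers. The base \<open>- 2\<close> merges the 2 contributed by each edge with the leading sign
  of the enumerator.\<close>

lemma alternating_enumerator_even:
  "2 ^ card (verts G) * alternating_enumerator Phi_even G
    = (- 2) ^ card (edges G) * int (card {A \<in> Pow (verts G). \<forall>e\<in>edges G. odd (card (e \<inter> A))})"
proof -
  have "2 ^ card (verts G) *
        (\<Sum>S\<in>Pow (edges G). (- 1) ^ card S * of_bool (Phi_even (edge_subgraph G S)))
      = (\<Sum>S\<in>Pow (edges G). (- 1) ^ card S *
          (2 ^ card (verts G) * of_bool (Phi_even (edge_subgraph G S))) :: int)"
    by (simp add: sum_distrib_left mult_ac)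
  also have "\<dots> = (\<Sum>S\<in>Pow (edges G). (- 1) ^ card S *
      (\<Sum>A\<in>Pow (verts G). \<Prod>e\<in>S. (- 1) ^ card (e \<inter> A)))"
  proof (rule sum.cong[OF refl])
    fix S assume "S \<in> Pow (edges G)"
    then have S: "finite S"
      using finite_edges finite_subset by auto
    have "2 ^ card (verts G) * of_bool (Phi_even (edge_subgraph G S))
        = (\<Sum>A\<in>Pow (verts G). \<Prod>v\<in>A. (- 1 :: int) ^ vertex_degree (edge_subgraph G S) v)"
      using sum_characters_even[of "edge_subgraph G S"] finite_verts
      by (simp add: edge_subgraph_def)
    also have "\<dots> = (\<Sum>A\<in>Pow (verts G). \<Prod>e\<in>S. (- 1) ^ card (e \<inter> A))"
      using S finite_subset[OF _ finite_verts]
      by (intro sum.cong[OF refl]) (simp add: prod_minus_one_degree edge_subgraph_def)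
    finally show "(- 1) ^ card S * (2 ^ card (verts G) * of_bool (Phi_even (edge_subgraph G S)))
      = (- 1 :: int) ^ card S * (\<Sum>A\<in>Pow (verts G). \<Prod>e\<in>S. (- 1) ^ card (e \<inter> A))"
      by simp
  qed
  \<comment> \<open>The sign \<open>(- 1) ^ card S\<close> is spread over the edges of
    \<open>S\<close>, so that the inner sum becomes an expanded product.\<close>
  also have "\<dots> = (\<Sum>A\<in>Pow (verts G). \<Sum>S\<in>Pow (edges G). \<Prod>e\<in>S. - ((- 1) ^ card (e \<inter> A)))"
    unfolding sum_distrib_left prod_uminus by (rule sum.swap)
  also have "\<dots> = (\<Sum>A\<in>Pow (verts G).
      2 ^ card (edges G) * of_bool (\<forall>e\<in>edges G. odd (card (e \<inter> A))))"
    using finite_edges by (subst prod_cut_indicator[symmetric]) (simp add: sum_Pow_prod)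
  also have "\<dots> = 2 ^ card (edges G) *
      int (card {A \<in> Pow (verts G). \<forall>e\<in>edges G. odd (card (e \<inter> A))})"
    using finite_verts by (simp add: Int_def flip: sum_distrib_left)
  finally show ?thesis
    by (simp add: alternating_enumerator_def power_minus[of 2] mult_ac)
qed

text \<open>An edge has two ends, so odd intersection with \<open>A\<close> means exactly one end in
  \<open>A\<close>; the two sides are then \<open>A\<close> and its complement.\<close>

lemma bipartite_iff_cut:
  "bipartite G \<longleftrightarrow> (\<exists>A\<subseteq>verts G. \<forall>e\<in>edges G. odd (card (e \<inter> A)))"
proof
  assume "bipartite G"
  then obtain X Y where XY: "verts G = X \<union> Y" "X \<inter> Y = {}"
    and e: "\<forall>e\<in>edges G. \<exists>x\<in>X. \<exists>y\<in>Y. e = {x, y}"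
    unfolding bipartite_def by auto
  have "odd (card (a \<inter> X))" if a: "a \<in> edges G" for a
  proof -
    obtain x y where "x \<in> X" "y \<in> Y" "a = {x, y}"
      using bspec[OF e a] by (elim bexE)
    then have "a \<inter> X = {x}" using XY(2) by auto
    then show ?thesis by simp
  qed
  then show "\<exists>A\<subseteq>verts G. \<forall>e\<in>edges G. odd (card (e \<inter> A))"
    using XY by blast
next
  assume "\<exists>A\<subseteq>verts G. \<forall>e\<in>edges G. odd (card (e \<inter> A))"
  then obtain A where A: "A \<subseteq> verts G" "\<forall>e\<in>edges G. odd (card (e \<inter> A))" by auto
  have "\<exists>x\<in>A. \<exists>y\<in>verts G - A. e = {x, y}" if e: "e \<in> edges G" for e
  proof -
    obtain u v where uv: "e = {u, v}" "u \<noteq> v"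
      using card_edge[OF e] by (auto simp: card_2_iff)
    have "u \<in> verts G" "v \<in> verts G" using edge_subset_verts[OF e] uv by auto
    moreover have "odd (card ({u, v} \<inter> A))" using A e uv by auto
    ultimately show ?thesis
      using uv by (cases "u \<in> A"; cases "v \<in> A") (auto simp: insert_commute)
  qed
  then show "bipartite G"
    unfolding bipartite_def using A by (intro exI[of _ A] exI[of _ "verts G - A"]) auto
qed

end

theorem theorem6p1:
  fixes H :: "'a ugraph"
  assumes "finite_simple_graph H"
  shows "alternating_enumerator Phi_even H \<noteq> 0 \<longleftrightarrow> bipartite H"
proof -
  interpret finite_simple_graph H by fact
  let ?C = "{A \<in> Pow (verts H). \<forall>e\<in>edges H. odd (card (e \<inter> A))}"
  have "alternating_enumerator Phi_even H \<noteq> 0 \<longleftrightarrow> card ?C \<noteq> 0"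
  proof -
    have "alternating_enumerator Phi_even H \<noteq> 0
        \<longleftrightarrow> 2 ^ card (verts H) * alternating_enumerator Phi_even H \<noteq> 0"
      by simp
    \<comment> \<open>A power of \<open>- 2\<close> is nonzero, so only the count can
      vanish.\<close>
    also have "\<dots> \<longleftrightarrow> card ?C \<noteq> 0"
      unfolding alternating_enumerator_even by simp
    finally show ?thesis .
  qed
  \<comment> \<open>Finiteness matters, since \<open>card\<close> is 0 on infinite sets.\<close>
  also have "\<dots> \<longleftrightarrow> ?C \<noteq> {}"
    using finite_verts by simp
  also have "\<dots> \<longleftrightarrow> bipartite H"
    by (auto simp: bipartite_iff_cut)
  finally show ?thesis .
qed

end
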